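(* Let $R$ be a finite proper nearfield and let $k\ge 1$ be an integer. Then $$\operatorname{mdim}(k,R)=\frac{|R|^k-1}{|R|-1}.$$
   Context: A (left) nearfield is a set $R$ with two operations $+,\cdot$ such that $(R,+)$ is a group (it is automatically abelian), multiplication is associative, $a(b+c)=ab+ac$ for all $a,b,c\in R$, $0\cdot r=r\cdot 0=0$ for all $r\in R$, and $R\setminus\{0\}$ is a group under multiplication. A nearfield $R$ is proper if it is not a skewfield, i.e. there exist $a,b,c\in R$ with $(a+b)c\ne ac+bc$. $R^n$ carries coordinatewise addition and the right scalar multiplication $(v_1,\ldots,v_n)r=(v_1r,\ldots,v_nr)$ for $r\in R$. An $R$-subgroup of $R^n$ is a subgroup $H$ of $(R^n,+)$ such that $hr\in H$ for all $h\in H$, $r\in R$. For $V\subseteq R^n$, $\operatorname{gen}(V)$ denotes the intersection of all $R$-subgroups of $R^n$ containing $V$; we write $\operatorname{gen}(v_1,\ldots,v_k)$ for $\operatorname{gen}(\{v_1,\ldots,v_k\})$. For an integer $k\ge1$, $$\operatorname{mdim}(k,R)=\max\{n:\ \exists\, v_1,\ldots,v_k\in R^n \text{ such that } \operatorname{gen}(v_1,\ldots,v_k)=R^n\}.$$ *)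

theory Defs
  imports Complex_Main "HOL-Algebra.Multiplicative_Group" "HOL-Algebra.Product_Groups"
begin

text \<open>Left nearfields; \<open>mult_of R\<close> is the multiplicative structure on the nonzero elements.\<close>

locale nearfield =
  fixes R :: "('a, 'b) ring_scheme" (structure)
  assumes add_group: "group (add_monoid R)"
    and m_closed: "\<lbrakk>a \<in> carrier R; b \<in> carrier R\<rbrakk> \<Longrightarrow> a \<otimes> b \<in> carrier R"
    and m_assoc: "\<lbrakk>a \<in> carrier R; b \<in> carrier R; c \<in> carrier R\<rbrakk>
      \<Longrightarrow> (a \<otimes> b) \<otimes> c = a \<otimes> (b \<otimes> c)"
    and l_distrib_sum: "\<lbrakk>a \<in> carrier R; b \<in> carrier R; c \<in> carrier R\<rbrakk>
      \<Longrightarrow> a \<otimes> (b \<oplus> c) = (a \<otimes> b) \<oplus> (a \<otimes> c)"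
    and zero_mult: "r \<in> carrier R \<Longrightarrow> \<zero> \<otimes> r = \<zero>"
    and mult_zero: "r \<in> carrier R \<Longrightarrow> r \<otimes> \<zero> = \<zero>"
    and mult_group: "group (mult_of R)"

locale proper_nearfield = nearfield +
  assumes proper: "\<exists>a\<in>carrier R. \<exists>b\<in>carrier R. \<exists>c\<in>carrier R.
    (a \<oplus> b) \<otimes> c \<noteq> (a \<otimes> c) \<oplus> (b \<otimes> c)"

text \<open>The additive group \<open>R\<^sup>n\<close>; vectors are extensional functions on \<open>{..<n}\<close>.\<close>

definition vec_group :: "('a, 'b) ring_scheme \<Rightarrow> nat \<Rightarrow> (nat \<Rightarrow> 'a) monoid" where
  "vec_group R n = product_group {..<n} (\<lambda>_. add_monoid R)"

definition scale :: "('a, 'b) ring_scheme \<Rightarrow> nat \<Rightarrow> (nat \<Rightarrow> 'a) \<Rightarrow> 'a \<Rightarrow> (nat \<Rightarrow> 'a)" where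
  "scale R n v r = (\<lambda>i\<in>{..<n}. v i \<otimes>\<^bsub>R\<^esub> r)"

definition R_subgroup :: "('a, 'b) ring_scheme \<Rightarrow> nat \<Rightarrow> (nat \<Rightarrow> 'a) set \<Rightarrow> bool" where
  "R_subgroup R n H \<longleftrightarrow>
     subgroup H (vec_group R n) \<and> (\<forall>h\<in>H. \<forall>r\<in>carrier R. scale R n h r \<in> H)"

definition gen :: "('a, 'b) ring_scheme \<Rightarrow> nat \<Rightarrow> (nat \<Rightarrow> 'a) set \<Rightarrow> (nat \<Rightarrow> 'a) set" where
  "gen R n V = \<Inter> {H. R_subgroup R n H \<and> V \<subseteq> H}"

text \<open>The vectors \<open>v 1, \<dots>, v k\<close> need not be distinct.\<close>

definition gen_dims :: "nat \<Rightarrow> ('a, 'b) ring_scheme \<Rightarrow> nat set" where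
  "gen_dims k R = {n. \<exists>v. (\<forall>i\<in>{1..k}. v i \<in> carrier (vec_group R n)) \<and>
     gen R n (v ` {1..k}) = carrier (vec_group R n)}"

text \<open>\<open>Max\<close> is unspecified on infinite sets, so a claim about \<open>mdim k R\<close> is meaningful
  only together with finiteness of \<open>gen_dims k R\<close>.\<close>

definition mdim :: "nat \<Rightarrow> ('a, 'b) ring_scheme \<Rightarrow> nat" where
  "mdim k R = Max (gen_dims k R)"

end

theory Submission
  imports Defs
begin

text \<open>
  View \<open>v\<^sub>1, \<dots>, v\<^sub>k \<in> R\<^sup>n\<close> as the rows of a \<open>k \<times> n\<close> matrix. If a column is zero, or one column is
  a left multiple of another, then that relation cuts out a proper \<open>R\<close>-subgroup containing all rows,
  because left multiplications are additive and commute with right scaling. Conversely, suppose that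
  an \<open>R\<close>-subgroup satisfies no such relation and projects onto the coordinates in \<open>J\<close>. If it does
  not project onto \<open>J \<union> {j}\<close>, then the coordinate \<open>j\<close> is a function \<open>\<Sum> a\<^sub>i x\<^sub>i\<close> of those in \<open>J\<close>;
  compatibility with right scaling and two nonzero coefficients would force right distributivity,
  and at most one nonzero coefficient gives an excluded relation. Hence \<open>mdim\<close> counts the orbits of
  the free left action of \<open>R - {0}\<close> on \<open>R\<^sup>k - {0}\<close>.
\<close>

section \<open>Nearfield arithmetic\<close>

context nearfield
begin

sublocale add: group "add_monoid R"
  rewrites "carrier (add_monoid R) = carrier R"
    and "mult (add_monoid R) = add R"
    and "one (add_monoid R) = \<zero>"
    and "m_inv (add_monoid R) = a_inv R"
  by (rule add_group) (auto simp: a_inv_def)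

sublocale mult: group "mult_of R"
  rewrites "carrier (mult_of R) = carrier R - {\<zero>}"
    and "mult (mult_of R) = mult R"
    and "one (mult_of R) = \<one>"
  by (rule mult_group) auto

lemma one_mult: "a \<in> carrier R \<Longrightarrow> \<one> \<otimes> a = a"
  using mult.l_one[of a] mult_zero[of \<one>] mult.one_closed by (cases "a = \<zero>") auto

lemma mult_eq_zero_iff:
  assumes "a \<in> carrier R" "b \<in> carrier R"
  shows "a \<otimes> b = \<zero> \<longleftrightarrow> a = \<zero> \<or> b = \<zero>"
  using assms mult.m_closed[of a b] zero_mult mult_zero by auto

lemma mult_uminus:
  assumes "a \<in> carrier R" "b \<in> carrier R"
  shows "a \<otimes> (\<ominus> b) = \<ominus> (a \<otimes> b)"
proof -
  have "(a \<otimes> (\<ominus> b)) \<oplus> (a \<otimes> b) = \<zero>"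
    using assms l_distrib_sum[of a "\<ominus> b" b] mult_zero by simp
  then show ?thesis
    using assms by (intro add.inv_equality[symmetric]) (auto intro: m_closed)
qed

lemma left_divide:
  assumes "a \<in> carrier R - {\<zero>}" "b \<in> carrier R"
  shows "\<exists>x\<in>carrier R. a \<otimes> x = b"
proof -
  obtain a' where a': "a' \<in> carrier R - {\<zero>}" "a \<otimes> a' = \<one>"
    using mult.r_inv_ex[OF assms(1)] by blast
  then have "a \<otimes> (a' \<otimes> b) = b"
    using assms m_assoc[of a a' b] one_mult by auto
  then show ?thesis using a' assms m_closed by blast
qed

section \<open>The groups \<open>R\<^sup>n\<close> and their \<open>R\<close>-subgroups\<close>

lemma carrier_vec_group: "carrier (vec_group R n) = {..<n} \<rightarrow>\<^sub>E carrier R"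
  by (simp add: vec_group_def)

lemma group_vec_group: "group (vec_group R n)"
  unfolding vec_group_def by (rule product_group) (rule add_group)

lemma inv_vec_group:
  assumes "x \<in> carrier (vec_group R n)"
  shows "inv\<^bsub>vec_group R n\<^esub> x = (\<lambda>i\<in>{..<n}. \<ominus> x i)"
  unfolding vec_group_def a_inv_def
  using assms by (intro inv_product_group) (auto simp: vec_group_def add_group)

lemma subgroup_vec_group_iff:
  "subgroup H (vec_group R n) \<longleftrightarrow>
    H \<subseteq> ({..<n} \<rightarrow>\<^sub>E carrier R) \<and> (\<lambda>i\<in>{..<n}. \<zero>) \<in> H \<and>
    (\<forall>x\<in>H. \<forall>y\<in>H. (\<lambda>i\<in>{..<n}. x i \<oplus> y i) \<in> H) \<and>
    (\<forall>x\<in>H. (\<lambda>i\<in>{..<n}. \<ominus> x i) \<in> H)" (is "?L \<longleftrightarrow> ?R")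
proof
  assume ?L
  then interpret subgroup H "vec_group R n" .
  have "(\<lambda>i\<in>{..<n}. \<ominus> x i) \<in> H" if "x \<in> H" for x
    using m_inv_closed[OF that] inv_vec_group[OF mem_carrier[OF that]] by simp
  moreover have "(\<lambda>i\<in>{..<n}. x i \<oplus> y i) \<in> H" if "x \<in> H" "y \<in> H" for x y
    using m_closed[OF that] by (simp add: vec_group_def)
  moreover have "(\<lambda>i\<in>{..<n}. \<zero>) \<in> H"
    using one_closed by (simp add: vec_group_def)
  ultimately show ?R
    using subset by (simp add: carrier_vec_group)
next
  assume R: ?R
  show ?L
  proof
    fix x assume "x \<in> H"
    with R have "x \<in> carrier (vec_group R n)" by (auto simp: carrier_vec_group)
    with R \<open>x \<in> H\<close> show "inv\<^bsub>vec_group R n\<^esub> x \<in> H" by (auto simp: inv_vec_group)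
  next
    show "H \<subseteq> carrier (vec_group R n)" using R by (simp add: carrier_vec_group)
  next
    show "\<one>\<^bsub>vec_group R n\<^esub> \<in> H" using R by (simp add: vec_group_def)
  next
    fix x y assume "x \<in> H" "y \<in> H"
    with R have "(\<lambda>i\<in>{..<n}. x i \<oplus> y i) \<in> H" by blast
    then show "x \<otimes>\<^bsub>vec_group R n\<^esub> y \<in> H" by (simp add: vec_group_def)
  qed
qed

lemma R_subgroup_vec_group: "R_subgroup R n (carrier (vec_group R n))"
proof -
  have "scale R n h r \<in> carrier (vec_group R n)"
    if "h \<in> carrier (vec_group R n)" "r \<in> carrier R" for h r
    using that by (auto simp: carrier_vec_group scale_def intro!: m_closed)
  then show ?thesis
    using group.subgroup_self[OF group_vec_group] by (simp add: R_subgroup_def)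
qed

text \<open>The whole space belongs to the intersected family because \<open>V\<close> lies in it.
  For other \<open>V\<close> that family would be empty and \<open>gen\<close> would be
  \<open>UNIV\<close>.\<close>

lemma R_subgroup_gen:
  assumes "V \<subseteq> carrier (vec_group R n)"
  shows "R_subgroup R n (gen R n V)"
proof -
  have "subgroup (gen R n V) (vec_group R n)"
    unfolding gen_def
    using R_subgroup_vec_group assms
    by (intro group.subgroups_Inter[OF group_vec_group]) (auto simp: R_subgroup_def)
  then show ?thesis
    by (auto simp: R_subgroup_def gen_def)
qed

lemma gen_subset: "R_subgroup R n H \<Longrightarrow> V \<subseteq> H \<Longrightarrow> gen R n V \<subseteq> H"
  by (auto simp: gen_def)

lemma subset_gen: "V \<subseteq> gen R n V"
  by (auto simp: gen_def)

section \<open>Coordinate relations that obstruct generation\<close>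

lemma R_subgroup_zero_coord:
  assumes "j < n"
  shows "R_subgroup R n {x \<in> {..<n} \<rightarrow>\<^sub>E carrier R. x j = \<zero>}"
proof -
  have c: "x l \<in> carrier R" if "x \<in> {..<n} \<rightarrow>\<^sub>E carrier R" "l < n" for x l
    using that by auto
  show ?thesis
    unfolding R_subgroup_def subgroup_vec_group_iff
    using assms by (auto simp: scale_def zero_mult c intro!: m_closed)
qed

lemma R_subgroup_proportional:
  assumes "i < n" "j < n" "s \<in> carrier R"
  shows "R_subgroup R n {x \<in> {..<n} \<rightarrow>\<^sub>E carrier R. x i = s \<otimes> x j}"
proof -
  have c: "x l \<in> carrier R" if "x \<in> {..<n} \<rightarrow>\<^sub>E carrier R" "l < n" for x l
    using that by auto
  show ?thesis
    unfolding R_subgroup_def subgroup_vec_group_iff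
    using assms
    by (auto simp: scale_def mult_zero l_distrib_sum mult_uminus m_assoc c intro!: m_closed)
qed

text \<open>Column conditions on the matrix whose rows form \<open>V\<close>;
  \<open>s = \<zero>\<close> in the second clause is covered by the first. Each clause asks for a
  witness in \<open>V\<close>, so the property passes to larger sets, in particular from
  \<open>V\<close> to \<open>gen R n V\<close>.\<close>

definition independent_coords :: "nat \<Rightarrow> (nat \<Rightarrow> 'a) set \<Rightarrow> bool" where
  "independent_coords n V \<longleftrightarrow>
     (\<forall>j<n. \<exists>v\<in>V. v j \<noteq> \<zero>) \<and>
     (\<forall>i<n. \<forall>j<n. \<forall>s\<in>carrier R - {\<zero>}. i \<noteq> j \<longrightarrow> (\<exists>v\<in>V. v i \<noteq> s \<otimes> v j))"

lemma independent_coords_mono: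
  "independent_coords n V \<Longrightarrow> V \<subseteq> W \<Longrightarrow> independent_coords n W"
  unfolding independent_coords_def by (meson subsetD)

lemma independent_coords_if_gen:
  assumes V: "V \<subseteq> carrier (vec_group R n)"
    and gen: "gen R n V = carrier (vec_group R n)"
  shows "independent_coords n V"
proof -
  have "\<exists>v\<in>V. v j \<noteq> \<zero>" if j: "j < n" for j
  proof (rule ccontr)
    assume "\<not> ?thesis"
    then have "gen R n V \<subseteq> {x \<in> {..<n} \<rightarrow>\<^sub>E carrier R. x j = \<zero>}"
      using j V by (intro gen_subset R_subgroup_zero_coord) (auto simp: carrier_vec_group)
    moreover have "(\<lambda>i\<in>{..<n}. \<one>) \<in> gen R n V"
      using gen mult.one_closed by (auto simp: carrier_vec_group)
    ultimately have "(\<lambda>i\<in>{..<n}. \<one>) j = \<zero>" by blast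
    then show False using j mult.one_closed by simp
  qed
  moreover have "\<exists>v\<in>V. v i \<noteq> s \<otimes> v j"
    if ij: "i < n" "j < n" "i \<noteq> j" and s: "s \<in> carrier R - {\<zero>}" for i j s
  proof (rule ccontr)
    assume "\<not> ?thesis"
    then have "gen R n V \<subseteq> {x \<in> {..<n} \<rightarrow>\<^sub>E carrier R. x i = s \<otimes> x j}"
      using ij s V by (intro gen_subset R_subgroup_proportional) (auto simp: carrier_vec_group)
    \<comment> \<open>The unit vector at \<open>i\<close> breaks the relation: it has
      \<open>\<one>\<close> at \<open>i\<close>, but \<open>s \<otimes> \<zero> = \<zero>\<close> is
      demanded there.\<close>
    moreover have "(\<lambda>l\<in>{..<n}. if l = i then \<one> else \<zero>) \<in> gen R n V"
      using gen mult.one_closed by (auto simp: carrier_vec_group)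
    ultimately have "(\<lambda>l\<in>{..<n}. if l = i then \<one> else \<zero>) i
        = s \<otimes> (\<lambda>l\<in>{..<n}. if l = i then \<one> else \<zero>) j"
      by blast
    then have "\<one> = \<zero>" using ij mult_zero[of s] s by simp
    then show False using mult.one_closed by simp
  qed
  ultimately show ?thesis
    unfolding independent_coords_def by (intro conjI allI ballI impI)
qed

end

section \<open>Sufficiency of the column conditions in a proper nearfield\<close>

context proper_nearfield
begin

text \<open>Take \<open>u\<close>, \<open>v\<close>, \<open>r\<close> that violate right
  distributivity and divide: \<open>u = a \<otimes> x\<close>, \<open>v = b \<otimes> y\<close>. So
  a linear form with two nonzero left coefficients never commutes with right scaling.\<close>

lemma exists_not_right_distrib:
  assumes a: "a \<in> carrier R - {\<zero>}" and b: "b \<in> carrier R - {\<zero>}"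
  obtains x y r where "x \<in> carrier R" "y \<in> carrier R" "r \<in> carrier R"
    "(a \<otimes> x \<oplus> b \<otimes> y) \<otimes> r \<noteq> a \<otimes> (x \<otimes> r) \<oplus> b \<otimes> (y \<otimes> r)"
proof -
  obtain u v r where uvr: "u \<in> carrier R" "v \<in> carrier R" "r \<in> carrier R"
    "(u \<oplus> v) \<otimes> r \<noteq> u \<otimes> r \<oplus> v \<otimes> r" using proper by blast
  obtain x y where "x \<in> carrier R" "y \<in> carrier R" "a \<otimes> x = u" "b \<otimes> y = v"
    using left_divide a b uvr by meson
  with uvr a b that[of x y r] show thesis by (auto simp: m_assoc[symmetric])
qed

text \<open>Induction on \<open>J\<close>. To add a coordinate \<open>j\<close>, it suffices to find
  an element of \<open>H\<close> that vanishes on \<open>J\<close> but not at \<open>j\<close>: a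
  right multiple of it corrects coordinate \<open>j\<close> and leaves those in \<open>J\<close>
  alone.\<close>

lemma R_subgroup_projects_onto:
  assumes H: "R_subgroup R n H" and ind: "independent_coords n H"
  shows "\<lbrakk>finite J; J \<subseteq> {..<n}; x \<in> J \<rightarrow> carrier R\<rbrakk> \<Longrightarrow> \<exists>h\<in>H. \<forall>i\<in>J. h i = x i"
proof (induction J arbitrary: x rule: finite_induct)
  case empty
  then show ?case using H by (auto simp: R_subgroup_def subgroup_vec_group_iff)
next
  case (insert j J)
  have carr: "h i \<in> carrier R" if "h \<in> H" "i < n" for h i
    using H that by (auto simp: R_subgroup_def subgroup_vec_group_iff)
  have plus: "\<exists>d\<in>H. \<forall>i<n. d i = g i \<oplus> h i" if "g \<in> H" "h \<in> H" for g h
    using H that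
    by (intro bexI[of _ "\<lambda>i\<in>{..<n}. g i \<oplus> h i"]) (auto simp: R_subgroup_def subgroup_vec_group_iff)
  have diff: "\<exists>d\<in>H. \<forall>i<n. d i = g i \<oplus> \<ominus> h i" if "g \<in> H" "h \<in> H" for g h
  proof -
    have "(\<lambda>i\<in>{..<n}. \<ominus> h i) \<in> H"
      using H that by (auto simp: R_subgroup_def subgroup_vec_group_iff)
    from plus[OF that(1) this] show ?thesis by auto
  qed
  have smult: "\<exists>d\<in>H. \<forall>i<n. d i = h i \<otimes> r" if "h \<in> H" "r \<in> carrier R" for h r
    using H that by (intro bexI[of _ "scale R n h r"]) (auto simp: R_subgroup_def scale_def)
  have eq_iff: "g \<oplus> \<ominus> h = \<zero> \<longleftrightarrow> g = h" if "g \<in> carrier R" "h \<in> carrier R" for g h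
    using that by (metis add.inv_closed add.inv_inv add.inv_solve_right add.l_one add.one_closed)
  have j: "j < n" and J: "\<And>i. i \<in> J \<Longrightarrow> i < n" using insert.prems by auto
  obtain g where g: "g \<in> H" "\<forall>i\<in>J. g i = x i"
    using insert.IH[of x] insert.prems by auto
  have "\<exists>h\<in>H. (\<forall>i\<in>J. h i = \<zero>) \<and> h j \<noteq> \<zero>"
  proof (rule ccontr)
    assume "\<not> ?thesis"
    then have vanish: "h j = \<zero>" if "h \<in> H" "\<forall>i\<in>J. h i = \<zero>" for h
      using that by blast
    \<comment> \<open>Taking differences turns \<open>vanish\<close> into the statement that
      coordinate \<open>j\<close> is a function of the coordinates in \<open>J\<close>.\<close>
    have agree: "g j = h j" if gh: "g \<in> H" "h \<in> H" "\<forall>i\<in>J. g i = h i" for g h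
    proof -
      obtain d where "d \<in> H" "\<forall>i<n. d i = g i \<oplus> \<ominus> h i" using diff gh by blast
      with vanish[of d] gh eq_iff j J carr show ?thesis by auto
    qed
    \<comment> \<open>By the induction hypothesis, \<open>H\<close> contains lifts of the unit
      vectors of \<open>J\<close>. The entry \<open>e i j\<close> is the coefficient of
      \<open>x i\<close> in the form that expresses coordinate \<open>j\<close>.\<close>
    have "\<forall>i. \<exists>e\<in>H. \<forall>l\<in>J. e l = (if l = i then \<one> else \<zero>)"
      using insert.IH insert.prems mult.one_closed by auto
    then obtain e where e: "\<And>i. e i \<in> H" "\<And>i l. l \<in> J \<Longrightarrow> e i l = (if l = i then \<one> else \<zero>)"
      by metis
    \<comment> \<open>With two nonzero coefficients, scaling the combination \<open>d\<close> by
      \<open>r\<close> and combining the already scaled \<open>y \<otimes> r\<close>,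
      \<open>z \<otimes> r\<close> give the same coordinates in \<open>J\<close>, where at most one
      summand is nonzero, but different ones at \<open>j\<close>. This contradicts
      \<open>agree\<close>.\<close>
    have uniq: "e i j = \<zero> \<or> e i' j = \<zero>" if i: "i \<in> J" "i' \<in> J" "i \<noteq> i'" for i i'
    proof (rule ccontr)
      assume "\<not> ?thesis"
      then have "e i j \<in> carrier R - {\<zero>}" "e i' j \<in> carrier R - {\<zero>}"
        using carr e j by auto
      then obtain y z r where yzr: "y \<in> carrier R" "z \<in> carrier R" "r \<in> carrier R"
        and neq: "(e i j \<otimes> y \<oplus> e i' j \<otimes> z) \<otimes> r \<noteq> e i j \<otimes> (y \<otimes> r) \<oplus> e i' j \<otimes> (z \<otimes> r)"
        by (rule exists_not_right_distrib)
      have comb: "\<exists>d\<in>H. \<forall>l<n. d l = e i l \<otimes> p \<oplus> e i' l \<otimes> q"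
        if pq: "p \<in> carrier R" "q \<in> carrier R" for p q
      proof -
        obtain d d' where "d \<in> H" "\<forall>l<n. d l = e i l \<otimes> p" "d' \<in> H" "\<forall>l<n. d' l = e i' l \<otimes> q"
          using smult[OF e(1) pq(1)] smult[OF e(1) pq(2)] by blast
        with plus[of d d'] show ?thesis by auto
      qed
      obtain d where d: "d \<in> H" "\<forall>l<n. d l = e i l \<otimes> y \<oplus> e i' l \<otimes> z" using comb yzr by blast
      obtain dr where dr: "dr \<in> H" "\<forall>l<n. dr l = d l \<otimes> r" using smult d(1) yzr by blast
      obtain d' where d': "d' \<in> H" "\<forall>l<n. d' l = e i l \<otimes> (y \<otimes> r) \<oplus> e i' l \<otimes> (z \<otimes> r)"
        using comb[of "y \<otimes> r" "z \<otimes> r"] yzr m_closed by blast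
      have "dr l = d' l" if "l \<in> J" for l
        using that d dr d' J e i yzr by (auto simp: one_mult zero_mult m_closed)
      then have "dr j = d' j" using agree dr d' by blast
      with neq d dr d' j show False by auto
    qed
    \<comment> \<open>\<open>K\<close> contains the part of \<open>J\<close> where \<open>h\<close>
      may be nonzero. Subtracting \<open>e i\<close> scaled by \<open>h i\<close> clears coordinate
      \<open>i\<close> and, since \<open>e i j = \<zero>\<close>, does not change coordinate
      \<open>j\<close>; the induction ends at \<open>vanish\<close>.\<close>
    have supported: "finite K \<Longrightarrow>
      (\<forall>h\<in>H. K \<subseteq> J \<longrightarrow> (\<forall>i\<in>J - K. h i = \<zero>) \<longrightarrow> (\<forall>i\<in>K. e i j = \<zero>) \<longrightarrow> h j = \<zero>)" for K
    proof (induction K rule: finite_induct)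
      case empty
      then show ?case using vanish by auto
    next
      case (insert i K)
      show ?case
      proof (intro ballI impI)
        fix h assume h: "h \<in> H" "insert i K \<subseteq> J" "\<forall>l\<in>J - insert i K. h l = \<zero>"
          "\<forall>l\<in>insert i K. e l j = \<zero>"
        have hi: "h i \<in> carrier R" using h J carr by auto
        obtain f where f: "f \<in> H" "\<forall>l<n. f l = e i l \<otimes> h i" using smult e(1) hi by blast
        obtain d where d: "d \<in> H" "\<forall>l<n. d l = h l \<oplus> \<ominus> f l" using diff f h by blast
        have "d l = \<zero>" if "l \<in> J - K" for l
          using that h d f e J hi by (cases "l = i") (auto simp: one_mult zero_mult)
        then have "d j = \<zero>" using insert.IH[rule_format, of d] d(1) h(2,4) by simp
        then have "h j = f j" using eq_iff[of "h j" "f j"] carr[OF _ j] d(2) f(1) h j by simp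
        then show "h j = \<zero>" using f h j hi by (auto simp: zero_mult)
      qed
    qed
    show False
    proof (cases "\<exists>i\<in>J. e i j \<noteq> \<zero>")
      case True
      then obtain i where i: "i \<in> J" "e i j \<noteq> \<zero>" by blast
      have zeros: "\<forall>l\<in>J - {i}. e l j = \<zero>" using uniq i by blast
      \<comment> \<open>Here \<open>i\<close> carries the only nonzero coefficient. Removing the
        contribution of \<open>e i\<close> leaves an element that \<open>supported\<close> sends to
        \<open>\<zero>\<close> at \<open>j\<close>, so column \<open>j\<close> is a left multiple of
        column \<open>i\<close>, against independence.\<close>
      have "h j = e i j \<otimes> h i" if h: "h \<in> H" for h
      proof -
        have hi: "h i \<in> carrier R" using h i J carr by auto
        obtain f where f: "f \<in> H" "\<forall>l<n. f l = e i l \<otimes> h i" using smult e(1) hi by blast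
        obtain d where d: "d \<in> H" "\<forall>l<n. d l = h l \<oplus> \<ominus> f l" using diff f h by blast
        have "d i = \<zero>" using d f e J i hi by (auto simp: one_mult)
        then have "d j = \<zero>"
          using supported[of "J - {i}"] zeros d(1) insert.hyps(1) by auto
        then have "h j = f j" using eq_iff[of "h j" "f j"] carr[OF _ j] d(2) f(1) h j by simp
        then show ?thesis using f(2) j by simp
      qed
      moreover have "i \<noteq> j" "i < n" "e i j \<in> carrier R - {\<zero>}"
        using i insert.hyps(2) J e(1) carr j by auto
      ultimately show False
        using ind j unfolding independent_coords_def by metis
    next
      case False
      \<comment> \<open>With all coefficients zero, column \<open>j\<close> itself vanishes on
        \<open>H\<close>, which independence also excludes.\<close>
      then have "h j = \<zero>" if "h \<in> H" for h
        using supported[of J] that insert.hyps(1) by auto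
      then show False using ind j unfolding independent_coords_def by blast
    qed
  qed
  then obtain h where h: "h \<in> H" "\<forall>i\<in>J. h i = \<zero>" "h j \<noteq> \<zero>" by blast
  have xj: "x j \<in> carrier R" using insert.prems by auto
  \<comment> \<open>The correction is added on the left of \<open>g\<close> below, so that
    \<open>\<ominus> g j\<close> meets \<open>g j\<close> without appeal to commutativity.\<close>
  obtain r where r: "r \<in> carrier R" "h j \<otimes> r = x j \<oplus> \<ominus> g j"
    using left_divide[of "h j" "x j \<oplus> \<ominus> g j"] h j carr g xj by auto
  obtain f where f: "f \<in> H" "\<forall>l<n. f l = h l \<otimes> r" using smult h r by blast
  obtain d where d: "d \<in> H" "\<forall>l<n. d l = f l \<oplus> g l" using plus f g by blast
  have "x i \<in> carrier R" if "i \<in> J" for i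
    using insert.prems(2) that by auto
  then have "d i = x i" if "i \<in> J" for i
    using that d f g h J r by (simp add: zero_mult)
  moreover have "d j = x j"
    using d f r j xj carr[OF g(1) j] by (auto simp: add.m_assoc)
  ultimately show ?case using d by auto
qed

text \<open>For sufficiency, project \<open>gen R n V\<close> onto all of \<open>{..<n}\<close>;
  extensional vectors that agree there are equal.\<close>

lemma gen_eq_vec_group_iff:
  assumes V: "V \<subseteq> carrier (vec_group R n)"
  shows "gen R n V = carrier (vec_group R n) \<longleftrightarrow> independent_coords n V"
proof
  assume "independent_coords n V"
  then have ind: "independent_coords n (gen R n V)"
    using subset_gen by (rule independent_coords_mono)
  have sub: "gen R n V \<subseteq> {..<n} \<rightarrow>\<^sub>E carrier R"
    using gen_subset[OF R_subgroup_vec_group V] by (simp add: carrier_vec_group)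
  have "x \<in> gen R n V" if x: "x \<in> {..<n} \<rightarrow>\<^sub>E carrier R" for x
  proof -
    obtain h where h: "h \<in> gen R n V" "\<forall>i\<in>{..<n}. h i = x i"
      using R_subgroup_projects_onto[OF R_subgroup_gen[OF V] ind, of "{..<n}" x] x by auto
    then have "h = x" using sub x by (intro PiE_ext) auto
    with h show ?thesis by simp
  qed
  with sub show "gen R n V = carrier (vec_group R n)" by (auto simp: carrier_vec_group)
qed (rule independent_coords_if_gen[OF V])

end

section \<open>The left action of \<open>R - {0}\<close> on nonzero columns\<close>

context nearfield
begin

definition lscale :: "nat \<Rightarrow> 'a \<Rightarrow> (nat \<Rightarrow> 'a) \<Rightarrow> (nat \<Rightarrow> 'a)" where
  "lscale k s c = (\<lambda>l\<in>{1..k}. s \<otimes> c l)"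

definition nonzero_columns :: "nat \<Rightarrow> (nat \<Rightarrow> 'a) set" where
  "nonzero_columns k = ({1..k} \<rightarrow>\<^sub>E carrier R) - {\<lambda>l\<in>{1..k}. \<zero>}"

text \<open>The columns represent \<open>n\<close> distinct orbits of the left action.\<close>

definition inequivalent_columns :: "nat \<Rightarrow> nat \<Rightarrow> (nat \<Rightarrow> nat \<Rightarrow> 'a) \<Rightarrow> bool" where
  "inequivalent_columns k n c \<longleftrightarrow> (\<forall>i<n. c i \<in> nonzero_columns k) \<and>
     (\<forall>i<n. \<forall>j<n. \<forall>s\<in>carrier R - {\<zero>}. i \<noteq> j \<longrightarrow> c i \<noteq> lscale k s (c j))"

lemma nonzero_columnsD:
  assumes "c \<in> nonzero_columns k"
  shows "\<And>l. l \<in> {1..k} \<Longrightarrow> c l \<in> carrier R" and "\<exists>l\<in>{1..k}. c l \<noteq> \<zero>"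
proof -
  show "\<exists>l\<in>{1..k}. c l \<noteq> \<zero>"
  proof (rule ccontr)
    assume "\<not> (\<exists>l\<in>{1..k}. c l \<noteq> \<zero>)"
    moreover have "c \<in> extensional {1..k}"
      using assms by (simp add: nonzero_columns_def PiE_def)
    ultimately have "c = (\<lambda>l\<in>{1..k}. \<zero>)"
      by (intro extensionalityI[of _ "{1..k}"]) auto
    then show False using assms by (simp add: nonzero_columns_def)
  qed
qed (use assms in \<open>auto simp: nonzero_columns_def\<close>)

lemma nonzero_columnsI:
  assumes "c \<in> {1..k} \<rightarrow>\<^sub>E carrier R" "l \<in> {1..k}" "c l \<noteq> \<zero>"
  shows "c \<in> nonzero_columns k"
  using assms by (auto simp: nonzero_columns_def)

lemma lscale_nonzero_columns:
  assumes c: "c \<in> nonzero_columns k" and s: "s \<in> carrier R - {\<zero>}"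
  shows "lscale k s c \<in> nonzero_columns k"
proof -
  obtain l where "l \<in> {1..k}" "c l \<noteq> \<zero>" using nonzero_columnsD(2)[OF c] by blast
  then show ?thesis
    using nonzero_columnsD(1)[OF c] s
    by (intro nonzero_columnsI[of _ _ l]) (auto simp: lscale_def mult_eq_zero_iff m_closed)
qed

lemma lscale_lscale:
  assumes "c \<in> nonzero_columns k" "s \<in> carrier R" "t \<in> carrier R"
  shows "lscale k t (lscale k s c) = lscale k (t \<otimes> s) c"
  using assms nonzero_columnsD(1)[OF assms(1)] by (auto simp: lscale_def fun_eq_iff m_assoc)

lemma lscale_one:
  assumes "c \<in> nonzero_columns k"
  shows "lscale k \<one> c = c"
proof (rule extensionalityI[of _ "{1..k}"])
  show "c \<in> extensional {1..k}"
    using assms by (simp add: nonzero_columns_def PiE_def)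
qed (use nonzero_columnsD(1)[OF assms] in \<open>auto simp: lscale_def one_mult\<close>)

lemma lscale_solve:
  assumes s: "s \<in> carrier R - {\<zero>}"
  obtains t where "t \<in> carrier R - {\<zero>}"
    and "\<And>c. c \<in> nonzero_columns k \<Longrightarrow> lscale k t (lscale k s c) = c"
proof -
  obtain t where t: "t \<in> carrier R - {\<zero>}" "t \<otimes> s = \<one>"
    using mult.l_inv_ex[OF s] by blast
  then have "lscale k t (lscale k s c) = c" if "c \<in> nonzero_columns k" for c
    using that s by (simp add: lscale_lscale lscale_one)
  with t(1) show thesis by (rule that)
qed

text \<open>Freeness of the action: cancel a nonzero entry of \<open>c\<close> on the right.\<close>

lemma lscale_inj:
  assumes c: "c \<in> nonzero_columns k" and s: "s \<in> carrier R - {\<zero>}" and t: "t \<in> carrier R - {\<zero>}"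
    and eq: "lscale k s c = lscale k t c"
  shows "s = t"
proof -
  obtain l where l: "l \<in> {1..k}" "c l \<noteq> \<zero>" using nonzero_columnsD(2)[OF c] by blast
  have "s \<otimes> c l = t \<otimes> c l" using fun_cong[OF eq, of l] l by (simp add: lscale_def)
  then show ?thesis
    using mult.right_cancel[of "c l" s t] l s t nonzero_columnsD(1)[OF c] by auto
qed

section \<open>Counting orbits over a finite nearfield\<close>

context
  assumes fin: "finite (carrier R)"
begin

lemma finite_nonzero_columns: "finite (nonzero_columns k)"
  using fin by (simp add: nonzero_columns_def finite_PiE)

lemma card_nonzero_columns: "card (nonzero_columns k) = card (carrier R) ^ k - 1"
  using fin
  by (simp add: nonzero_columns_def card_Diff_subset card_PiE)

lemma card_nonzero: "card (carrier R - {\<zero>}) = card (carrier R) - 1"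
  using fin by (simp add: card_Diff_subset)

lemma card_carrier_ge_2: "card (carrier R) \<ge> 2"
proof -
  have "card {\<zero>, \<one>} \<le> card (carrier R)"
    using fin mult.one_closed by (intro card_mono) auto
  then show ?thesis using mult.one_closed by auto
qed

text \<open>The orbits of the \<open>c j\<close> are disjoint and, by freeness, each has
  \<open>card (carrier R) - 1\<close> elements; all lie among the nonzero columns.\<close>

lemma inequivalent_columns_bound:
  assumes c: "inequivalent_columns k n c"
  shows "n * (card (carrier R) - 1) \<le> card (carrier R) ^ k - 1"
proof -
  let ?U = "carrier R - {\<zero>}"
  let ?f = "\<lambda>(j, s). lscale k s (c j)"
  have nz: "c j \<in> nonzero_columns k" if "j < n" for j
    using c that by (simp add: inequivalent_columns_def)
  have "inj_on ?f ({..<n} \<times> ?U)"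
  proof (rule inj_onI)
    fix p q assume "p \<in> {..<n} \<times> ?U" "q \<in> {..<n} \<times> ?U" and pq: "?f p = ?f q"
    then obtain i s j t where [simp]: "p = (i, s)" "q = (j, t)"
      and ij: "i < n" "j < n" and st: "s \<in> ?U" "t \<in> ?U" by auto
    have eq: "lscale k s (c i) = lscale k t (c j)" using pq by simp
    \<comment> \<open>\<open>u\<close> inverts \<open>s\<close>, so \<open>c i\<close> becomes a
      left multiple of \<open>c j\<close> and inequivalence forces \<open>i = j\<close>.\<close>
    obtain u where u: "u \<in> ?U"
      "\<And>d. d \<in> nonzero_columns k \<Longrightarrow> lscale k u (lscale k s d) = d"
      using lscale_solve[OF st(1), of k] by blast
    have "c i = lscale k (u \<otimes> t) (c j)"
      using u(2)[OF nz[OF ij(1)]] eq lscale_lscale[OF nz[OF ij(2)], of t u] st u(1) by auto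
    moreover have "u \<otimes> t \<in> ?U" using u st mult.m_closed by blast
    ultimately have "i = j" using c ij unfolding inequivalent_columns_def by blast
    with eq lscale_inj nz ij st have "s = t" by blast
    with \<open>i = j\<close> show "p = q" by simp
  qed
  then have "card ({..<n} \<times> ?U) \<le> card (nonzero_columns k)"
    using lscale_nonzero_columns nz finite_nonzero_columns by (intro card_inj_on_le) auto
  then show ?thesis by (simp add: card_cartesian_product card_nonzero card_nonzero_columns)
qed

text \<open>Greedy choice: as long as the orbits chosen so far do not exhaust the nonzero columns,
  any column outside them can be added.\<close>

lemma inequivalent_columns_exist:
  "n * (card (carrier R) - 1) \<le> card (carrier R) ^ k - 1 \<Longrightarrow> \<exists>c. inequivalent_columns k n c"
proof (induction n)
  case 0
  then show ?case by (simp add: inequivalent_columns_def)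
next
  case (Suc n)
  let ?U = "carrier R - {\<zero>}"
  obtain c where c: "inequivalent_columns k n c" using Suc by auto
  let ?A = "(\<lambda>(j, s). lscale k s (c j)) ` ({..<n} \<times> ?U)"
  have "card (?A) \<le> n * (card (carrier R) - 1)"
    using card_image_le[of "{..<n} \<times> ?U" "\<lambda>(j, s). lscale k s (c j)"] fin
    by (simp add: card_cartesian_product card_nonzero)
  \<comment> \<open>Strict because the bound for \<open>Suc n\<close> leaves room for one more
    orbit, which is nonempty since \<open>card (carrier R) \<ge> 2\<close>.\<close>
  also have "\<dots> < card (nonzero_columns k)"
    using Suc.prems card_carrier_ge_2 by (simp add: card_nonzero_columns)
  finally have "\<not> nonzero_columns k \<subseteq> ?A"
    using fin card_mono[of "?A" "nonzero_columns k"] by auto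
  then obtain d where d: "d \<in> nonzero_columns k" "d \<notin> ?A" by blast
  have d1: "d \<noteq> lscale k s (c j)" if "j < n" "s \<in> ?U" for j s
    using d(2) that by force
  \<comment> \<open>Inequivalence is required in both orders; the reverse one follows from
    \<open>d1\<close> by inverting \<open>s\<close>.\<close>
  have d2: "c j \<noteq> lscale k s d" if js: "j < n" "s \<in> ?U" for j s
  proof
    assume eq: "c j = lscale k s d"
    obtain u where "u \<in> ?U" "\<And>d. d \<in> nonzero_columns k \<Longrightarrow> lscale k u (lscale k s d) = d"
      using lscale_solve[OF js(2), of k] by blast
    then show False using d1[of j u] eq d js by auto
  qed
  have "inequivalent_columns k (Suc n) (c(n := d))"
    using c d(1) d1 d2 unfolding inequivalent_columns_def by (auto simp: less_Suc_eq)
  then show ?case by blast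
qed

end

section \<open>Passing between rows and columns\<close>

lemma independent_coords_iff_inequivalent_columns:
  assumes v: "\<And>l. l \<in> {1..k} \<Longrightarrow> v l \<in> carrier (vec_group R n)"
  shows "independent_coords n (v ` {1..k}) \<longleftrightarrow> inequivalent_columns k n (\<lambda>i. \<lambda>l\<in>{1..k}. v l i)"
proof -
  have carr: "v l i \<in> carrier R" if "l \<in> {1..k}" "i < n" for l i
    using v[OF that(1)] that by (auto simp: carrier_vec_group)
  have restrict_eq: "(\<lambda>l\<in>{1..k}. f l) = (\<lambda>l\<in>{1..k}. g l) \<longleftrightarrow> (\<forall>l\<in>{1..k}. f l = g l)"
    for f g :: "nat \<Rightarrow> 'a"
    by (metis restrict_apply' restrict_ext)
  \<comment> \<open>A witness in the image of \<open>v\<close> is the same as a witnessing index, so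
    repeated rows do no harm.\<close>
  have nonzero: "(\<exists>w\<in>v ` {1..k}. w i \<noteq> \<zero>) \<longleftrightarrow> (\<lambda>l\<in>{1..k}. v l i) \<in> nonzero_columns k"
    if "i < n" for i
  proof -
    have "(\<lambda>l\<in>{1..k}. v l i) \<in> {1..k} \<rightarrow>\<^sub>E carrier R" using carr that by auto
    then show ?thesis
      unfolding nonzero_columns_def Diff_iff singleton_iff restrict_eq bex_simps(7)
      by (simp only: ball_simps(10) simp_thms)
  qed
  have proportional: "(\<exists>w\<in>v ` {1..k}. w i \<noteq> s \<otimes> w j) \<longleftrightarrow>
      (\<lambda>l\<in>{1..k}. v l i) \<noteq> lscale k s (\<lambda>l\<in>{1..k}. v l j)" for i j s
  proof -
    have "lscale k s (\<lambda>l\<in>{1..k}. v l j) = (\<lambda>l\<in>{1..k}. s \<otimes> v l j)"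
      by (auto simp: lscale_def)
    then show ?thesis by (simp only: restrict_eq bex_simps(7) ball_simps(10))
  qed
  show ?thesis
    unfolding independent_coords_def inequivalent_columns_def proportional
    by (rule arg_cong2[where f = "(\<and>)"], rule all_cong[OF nonzero], assumption, rule refl)
qed

end

text \<open>Transposing the \<open>k\<close> by \<open>n\<close> matrix turns the generation
  criterion for its rows into a condition on its columns.\<close>

lemma (in proper_nearfield) gen_dims_iff:
  "n \<in> gen_dims k R \<longleftrightarrow> (\<exists>c. inequivalent_columns k n c)"
proof
  assume "n \<in> gen_dims k R"
  then obtain v where v: "\<And>l. l \<in> {1..k} \<Longrightarrow> v l \<in> carrier (vec_group R n)"
    and "gen R n (v ` {1..k}) = carrier (vec_group R n)"
    unfolding gen_dims_def by blast
  then have "independent_coords n (v ` {1..k})"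
    by (intro independent_coords_if_gen) auto
  then show "\<exists>c. inequivalent_columns k n c"
    using independent_coords_iff_inequivalent_columns[of k v n] v by auto
next
  assume "\<exists>c. inequivalent_columns k n c"
  then obtain c where c: "inequivalent_columns k n c" by blast
  define v where "v l = (\<lambda>i\<in>{..<n}. c i l)" for l
  have nz: "c i \<in> nonzero_columns k" if "i < n" for i
    using c that by (simp add: inequivalent_columns_def)
  have v: "v l \<in> carrier (vec_group R n)" if "l \<in> {1..k}" for l
    using nonzero_columnsD(1)[OF nz that] by (auto simp: v_def carrier_vec_group)
  \<comment> \<open>Transposing back recovers \<open>c i\<close> exactly, because nonzero columns
    are extensional on \<open>{1..k}\<close>.\<close>
  have "(\<lambda>l\<in>{1..k}. v l i) = c i" if "i < n" for i
    using nz[OF that] that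
    by (auto simp: v_def fun_eq_iff nonzero_columns_def PiE_def extensional_def)
  then have "inequivalent_columns k n (\<lambda>i. \<lambda>l\<in>{1..k}. v l i)"
    using c unfolding inequivalent_columns_def by simp
  then have "independent_coords n (v ` {1..k})"
    using independent_coords_iff_inequivalent_columns[of k v n] v by auto
  then have "gen R n (v ` {1..k}) = carrier (vec_group R n)"
    using v by (subst gen_eq_vec_group_iff) auto
  moreover have "\<forall>l\<in>{1..k}. v l \<in> carrier (vec_group R n)"
    using v by (rule ballI)
  ultimately show "n \<in> gen_dims k R"
    unfolding gen_dims_def by (intro CollectI exI conjI)
qed

section \<open>The maximum as a geometric sum\<close>

theorem theorem20:
  fixes R :: "('a, 'b) ring_scheme" and k :: nat
  assumes "proper_nearfield R"
    and "finite (carrier R)"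
    and "k \<ge> 1"
  shows "finite (gen_dims k R) \<and>
    real (mdim k R) = (real (card (carrier R)) ^ k - 1) / (real (card (carrier R)) - 1)"
proof -
  interpret proper_nearfield R by fact
  define q where "q = card (carrier R)"
  \<comment> \<open>The geometric sum is the quotient as a natural number, so the division is exact
    and the orbit count is \<open>N\<close>.\<close>
  define N where "N = (\<Sum>i<k. q ^ i)"
  have q: "q \<ge> 2" unfolding q_def by (rule card_carrier_ge_2) fact
  have Nq: "real N * (real q - 1) = real q ^ k - 1"
    using power_diff_1_eq[of "real q" k] by (simp add: N_def)
  have "real (N * (q - 1)) = real (q ^ k - 1)"
    using Nq q by (simp add: of_nat_diff)
  then have Nq': "N * (q - 1) = q ^ k - 1" by linarith
  \<comment> \<open>The attainable dimensions form an initial segment, which gives both finiteness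
    and the value of \<open>Max\<close>.\<close>
  have dims: "n \<in> gen_dims k R \<longleftrightarrow> n \<le> N" for n
  proof -
    have "n \<in> gen_dims k R \<longleftrightarrow> n * (q - 1) \<le> q ^ k - 1"
      unfolding gen_dims_iff q_def
      using inequivalent_columns_bound inequivalent_columns_exist assms(2) by blast
    also have "\<dots> \<longleftrightarrow> n \<le> N" using q unfolding Nq'[symmetric] by simp
    finally show ?thesis .
  qed
  then have "gen_dims k R = {..N}" by auto
  moreover have "Max {..N} = N" by (intro Max_eqI) auto
  moreover have "real N = (real q ^ k - 1) / (real q - 1)"
    using Nq q by (simp add: eq_divide_eq)
  ultimately show ?thesis by (simp add: mdim_def q_def)
qed

end
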